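(* Let $n,m$ be relatively prime positive integers with $n\mid(m-1)^2$, let $l=\gcd(n,m-1)$, and let $k$ be a positive integer. Let $a_1,\dots,a_k$ be the first stairs on the first $k$ staircases of $I(n/m)$ (i.e. the $0$-th, $1$-st, ..., $(k-1)$-th staircases). Then a polynomial $p$ is an ascending $k$-stair packing polynomial on $S(n/m)$ if and only if $p$ is a $k$-stair polynomial on $S(n/m)$, $k\equiv\frac{m-1}{l}\pmod{\frac nl}$, $$p(x,y)=\frac n2\left(x-\frac{m-1}{n}y\right)^2+\left(1-\frac{kl}{2}\right)x+\frac{2(1-m)+kl(m+1)}{2n}y+f$$ for some $f\in\mathbb{R}$, and $$\{p(a_1),\dots,p(a_k)\}=\{0,1,\dots,k-1\}.$$
   Context: $\mathbb{N}=\{0,1,2,\dots\}$. For real $\alpha\ge 0$, $S(\alpha)=\{(x,y)\in\mathbb{R}^2 : x,y\ge 0,\ y\le \alpha x\}$ and $I(\alpha)=S(\alpha)\cap\mathbb{Z}^2$. A real polynomial $p(x,y)$ is a packing polynomial on $S(\alpha)$ if $p|_{I(\alpha)}$ is a bijection from $I(\alpha)$ to $\mathbb{N}$. For coprime positive integers $n,m$ and $l=\gcd(n,m-1)$, the $c$-th staircase ($c\in\mathbb{N}$) of $I(n/m)$ is the segment of points $(x,y)\in S(n/m)$ with $nx-(m-1)y=cl$ (for $m\ne 1$: $y=\frac{n}{m-1}x-c\frac{l}{m-1}$). A stair is a point with integer coordinates on a staircase. The first stair on a staircase is its stair with minimal $x$-coordinate (if $m=1$, with minimal $y$-coordinate).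 Two distinct stairs $r,s$ are consecutive if they lie on the same staircase and there is no other stair on the segment from $r$ to $s$. For $k\in\mathbb{N}$, a quadratic polynomial $p$ with homogeneous quadratic part $\frac n2\left(x-\frac{m-1}{n}y\right)^2$ and $p(\mathbb{Z}^2)\subseteq\mathbb{Z}$ is a $k$-stair polynomial on $S(n/m)$ if $p(r)-p(s)=\pm k$ for any two consecutive stairs $r,s$. It is ascending if $p(s)-p(r)=k$ whenever $r,s$ are consecutive stairs with $|r|<|s|$ (Euclidean norm). A $k$-stair packing polynomial is a $k$-stair polynomial that is also a packing polynomial on $S(n/m)$. *)

theory Defs
  imports
    "HOL-Analysis.Analysis"
    "HOL-Computational_Algebra.Polynomial"
    "HOL-Number_Theory.Cong"
begin

text \<open>A bivariate polynomial $p \in \mathbb{R}[x][y]$ is an element of \<^typ>\<open>real poly poly\<close>: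
  the outer variable is $y$, the inner one is $x$, so the coefficient of $x^i y^j$ is
  \<^term>\<open>coeff (coeff p j) i\<close>.\<close>

definition eval2 :: "real poly poly \<Rightarrow> real \<times> real \<Rightarrow> real" where
  "eval2 p = (\<lambda>(x, y). poly (poly p [:y:]) x)"

definition total_degree :: "real poly poly \<Rightarrow> nat" where
  "total_degree p = Max (insert 0 {i + j | i j. coeff (coeff p j) i \<noteq> 0})"

definition hom_part :: "nat \<Rightarrow> real poly poly \<Rightarrow> real poly poly" where
  "hom_part d p = (\<Sum>j\<le>d. monom (monom (coeff (coeff p j) (d - j)) (d - j)) j)"

definition sector :: "real \<Rightarrow> (real \<times> real) set" where
  "sector \<alpha> = {(x, y). 0 \<le> x \<and> 0 \<le> y \<and> y \<le> \<alpha> * x}"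

definition int_sector :: "real \<Rightarrow> (real \<times> real) set" where
  "int_sector \<alpha> = sector \<alpha> \<inter> (\<int> \<times> \<int>)"

definition packing_poly :: "real \<Rightarrow> real poly poly \<Rightarrow> bool" where
  "packing_poly \<alpha> p \<longleftrightarrow> bij_betw (eval2 p) (int_sector \<alpha>) \<nat>"

text \<open>From here on $n$ and $m$ are meant to be positive, so that the truncated difference
  \<^term>\<open>m - (1::nat)\<close> is the true one; for $m = 1$ the gcd is $n$.\<close>

definition staircase :: "nat \<Rightarrow> nat \<Rightarrow> nat \<Rightarrow> (real \<times> real) set" where
  "staircase n m c = {(x, y). (x, y) \<in> sector (real n / real m) \<and>
     real n * x - (real m - 1) * y = real c * real (gcd n (m - 1))}"

definition stairs_on :: "nat \<Rightarrow> nat \<Rightarrow> nat \<Rightarrow> (real \<times> real) set" where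
  "stairs_on n m c = staircase n m c \<inter> (\<int> \<times> \<int>)"

text \<open>If $n$ divides $(m-1)^2$, every staircase contains a stair, and the minimum below is
  attained at exactly one stair.\<close>

definition first_stair :: "nat \<Rightarrow> nat \<Rightarrow> nat \<Rightarrow> real \<times> real" where
  "first_stair n m c =
     (if m = 1 then ARG_MIN snd r. r \<in> stairs_on n m c
      else ARG_MIN fst r. r \<in> stairs_on n m c)"

definition consecutive_stairs ::
    "nat \<Rightarrow> nat \<Rightarrow> real \<times> real \<Rightarrow> real \<times> real \<Rightarrow> bool" where
  "consecutive_stairs n m r s \<longleftrightarrow>
     r \<noteq> s \<and> (\<exists>c. r \<in> stairs_on n m c \<and> s \<in> stairs_on n m c) \<and>
     (\<forall>c. \<forall>t \<in> stairs_on n m c. t \<in> closed_segment r s \<longrightarrow> t = r \<or> t = s)"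

definition stair_poly :: "nat \<Rightarrow> nat \<Rightarrow> nat \<Rightarrow> real poly poly \<Rightarrow> bool" where
  "stair_poly k n m p \<longleftrightarrow>
     total_degree p = 2 \<and>
     (\<forall>x y. eval2 (hom_part 2 p) (x, y) = real n / 2 * (x - (real m - 1) / real n * y)\<^sup>2) \<and>
     eval2 p ` (\<int> \<times> \<int>) \<subseteq> \<int> \<and>
     (\<forall>r s. consecutive_stairs n m r s \<longrightarrow>
        eval2 p r - eval2 p s = real k \<or> eval2 p r - eval2 p s = - real k)"

text \<open>The norm on \<^typ>\<open>real \<times> real\<close> is the Euclidean one.\<close>

definition ascending_stair_poly :: "nat \<Rightarrow> nat \<Rightarrow> nat \<Rightarrow> real poly poly \<Rightarrow> bool" where
  "ascending_stair_poly k n m p \<longleftrightarrow>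
     stair_poly k n m p \<and>
     (\<forall>r s. consecutive_stairs n m r s \<and> norm r < norm s \<longrightarrow>
        eval2 p s - eval2 p r = real k)"

definition ascending_stair_packing_poly ::
    "nat \<Rightarrow> nat \<Rightarrow> nat \<Rightarrow> real poly poly \<Rightarrow> bool" where
  "ascending_stair_packing_poly k n m p \<longleftrightarrow>
     ascending_stair_poly k n m p \<and> packing_poly (real n / real m) p"

end

theory Submission imports Defs begin

text \<open>Write $n = lN$ and $m - 1 = lM$; then $N$ and $M$ are coprime and $n \mid (m-1)^2$ says
  $N \mid l$. An integral point of the $c$-th staircase satisfies $Nx - My = c$ and
  $0 \le y \le cl$, so its $y$-coordinate runs through one residue class modulo $N$, and along
  this class an ascending $k$-stair polynomial increases in steps of $k$. Let $F(c)$ be its value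
  at the first stair and $L(c)$ the value at the first lattice point past the last stair.

  If $L(c) = F(c + k)$ for all $c$, the staircases $c, c + k, c + 2k, \dots$ together run through
  an arithmetic progression of step $k$ without gaps or repetitions, so packing only depends on
  $F(0), \dots, F(k - 1)$. Conversely, packing forces the range of $F$ to be the disjoint union of
  $\{0, \dots, k - 1\}$ and the range of $L$. As $F$ and $L$ eventually increase, counting gives
  $L(c) = F(c + k)$ for large $c$. Comparing coefficients, the difference of the $y$-coordinates of
  the two points, reduced by $cl$, is then constant in $c$; since one of them runs through a residue
  system $1, \dots, N$ and the other through $0, \dots, N - 1$, the constant is $1$. This determines
  the linear part of the polynomial and gives $k \equiv M$ modulo $N$, and then
  $L(c) = F(c + k)$ holds for all $c$.\<close>

section \<open>Bivariate quadratic polynomials\<close>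

lemma coeff_coeff_eq_0_total_degree:
  assumes "total_degree p < i + j"
  shows "coeff (coeff p j) i = 0"
proof (rule ccontr)
  let ?A = "{i + j | i j. coeff (coeff p j) i \<noteq> 0}"
  assume "coeff (coeff p j) i \<noteq> 0"
  then have "i + j \<in> ?A" by blast
  define D where "D = Max (degree ` coeff p ` {..degree p})"
  have "?A \<subseteq> {..D + degree p}"
  proof
    fix d assume "d \<in> ?A"
    then obtain i j where d: "d = i + j" and nz: "coeff (coeff p j) i \<noteq> 0" by blast
    then have "j \<le> degree p" by (metis coeff_0 le_degree)
    moreover have "i \<le> degree (coeff p j)" using nz by (rule le_degree)
    moreover have "degree (coeff p j) \<le> D"
      unfolding D_def using \<open>j \<le> degree p\<close> by (intro Max_ge) auto
    ultimately show "d \<in> {..D + degree p}" using d by simp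
  qed
  then have "finite ?A" by (rule finite_subset) simp
  then have "i + j \<le> total_degree p"
    unfolding total_degree_def using \<open>i + j \<in> ?A\<close> by (intro Max_ge) auto
  with assms show False by simp
qed

lemma poly_eq_sum_upto:
  fixes p :: "'a::comm_semiring_1 poly"
  assumes "\<And>i. i > d \<Longrightarrow> coeff p i = 0"
  shows "poly p x = (\<Sum>i\<le>d. coeff p i * x ^ i)"
proof -
  have "degree p \<le> d" using assms by (intro degree_le) auto
  have "poly p x = (\<Sum>i\<le>degree p. coeff p i * x ^ i)" by (rule poly_altdef)
  also have "\<dots> = (\<Sum>i\<le>d. coeff p i * x ^ i)"
    using \<open>degree p \<le> d\<close> by (intro sum.mono_neutral_left) (simp_all add: coeff_eq_0)
  finally show ?thesis .
qed

lemma eval2_quadratic: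
  assumes "total_degree p = 2"
  obtains a b f where
    "\<And>x y. eval2 p (x, y) = eval2 (hom_part 2 p) (x, y) + a * x + b * y + f"
proof -
  have z: "coeff (coeff p j) i = 0" if "i + j > 2" for i j
    using that assms by (intro coeff_coeff_eq_0_total_degree) simp
  have outer: "coeff p j = 0" if "j > 2" for j
    using z that by (intro poly_eqI) simp
  have inner: "poly (coeff p j) x = (\<Sum>i\<le>2. coeff (coeff p j) i * x ^ i)" for j x
    using z by (intro poly_eq_sum_upto) simp
  have "eval2 p (x, y) = (\<Sum>j\<le>2. poly (coeff p j) x * y ^ j)" for x y
    unfolding eval2_def using poly_eq_sum_upto[OF outer] by (simp add: poly_sum)
  moreover have "eval2 (hom_part 2 p) (x, y) =
      coeff (coeff p 0) 2 * x\<^sup>2 + coeff (coeff p 1) 1 * x * y + coeff (coeff p 2) 0 * y\<^sup>2" for x y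
    by (simp add: eval2_def hom_part_def numeral_2_eq_2 poly_monom)
  ultimately have "eval2 p (x, y) = eval2 (hom_part 2 p) (x, y) + coeff (coeff p 0) 1 * x +
      coeff (coeff p 1) 0 * y + coeff (coeff p 0) 0" for x y
    using z by (simp add: inner numeral_2_eq_2 algebra_simps)
  then show thesis by (rule that)
qed

section \<open>Tilings by arithmetic progressions\<close>

text \<open>Passing from a value \<open>v\<close> to \<open>v - k\<close> moves one step back inside
  a block, or from the start of block \<open>c + k\<close> to the end of block \<open>c\<close>.
  Induction on \<open>v\<close> along these moves gives existence and uniqueness of the
  index.\<close>

lemma bij_betw_progressions:
  fixes F len :: "nat \<Rightarrow> nat" and k :: nat
  assumes k: "k > 0" and len: "\<And>c. len c > 0"
    and step: "\<And>c. F (c + k) = F c + k * len c"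
    and init: "F ` {..<k} = {..<k}"
  shows "bij_betw (\<lambda>(c, j). F c + k * j) (SIGMA c:UNIV. {..<len c}) UNIV"
proof -
  have surj: "\<exists>c j. j < len c \<and> F c + k * j = v" for v
  proof (induction v rule: less_induct)
    case (less v)
    show ?case
    proof (cases "v < k")
      case True
      then have "v \<in> F ` {..<k}" using init by simp
      then show ?thesis using len by (metis add_0_right imageE mult_0_right)
    next
      case False
      with less k obtain c j where cj: "j < len c" "F c + k * j = v - k"
        by (metis diff_less gr_zeroI)
      show ?thesis
      proof (cases "Suc j < len c")
        case True
        with cj False show ?thesis by (intro exI[of _ c] exI[of _ "Suc j"]) simp
      next
        case last: False
        with cj have "len c = Suc j" by simp
        with cj False step[of c] len show ?thesis
          by (intro exI[of _ "c + k"] exI[of _ 0]) simp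
      qed
    qed
  qed
  have init_inj: "inj_on F {..<k}"
    using init by (intro eq_card_imp_inj_on) auto
  \<comment> \<open>The conditional records which move led back, so that an index can be recovered
    from its predecessor.\<close>
  have prev: "\<exists>c' j'. j' < len c' \<and> F c + k * j = F c' + k * Suc j' \<and>
      (if j = 0 then c = c' + k \<and> Suc j' = len c' else c = c' \<and> j = Suc j')"
    if "j < len c" "\<not> (j = 0 \<and> c < k)" for c j
  proof (cases j)
    case 0
    with that have "c = c - k + k" by simp
    moreover have "Suc (len (c - k) - 1) = len (c - k)" using len[of "c - k"] by simp
    ultimately show ?thesis using 0 step[of "c - k"] len[of "c - k"]
      by (intro exI[of _ "c - k"] exI[of _ "len (c - k) - 1"]) (simp del: mult_Suc_right)
  qed (use that in auto)
  have small: "F c + k * j < k \<longleftrightarrow> j = 0 \<and> c < k" if "j < len c" for c j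
  proof
    show "F c + k * j < k" if "j = 0 \<and> c < k" using init that by auto
    show "j = 0 \<and> c < k" if "F c + k * j < k"
      using prev[OF \<open>j < len c\<close>] that by fastforce
  qed
  have inj: "c = c' \<and> j = j'"
    if "j < len c" "j' < len c'" "F c + k * j = v" "F c' + k * j' = v" for v c j c' j'
    using that
  proof (induction v arbitrary: c j c' j' rule: less_induct)
    case (less v)
    show ?case
    proof (cases "v < k")
      case True
      then have "j = 0 \<and> c < k" "j' = 0 \<and> c' < k"
        using small[of j c] small[of j' c'] less.prems by simp_all
      then show ?thesis using init_inj less.prems by (auto dest: inj_onD)
    next
      case False
      then have "\<not> (j = 0 \<and> c < k)" "\<not> (j' = 0 \<and> c' < k)"
        using small[of j c] small[of j' c'] less.prems by simp_all
      from prev[OF less.prems(1) this(1)] obtain d i where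
        d: "i < len d" "F c + k * j = F d + k * Suc i"
          "if j = 0 then c = d + k \<and> Suc i = len d else c = d \<and> j = Suc i" by blast
      from prev[OF less.prems(2) \<open>\<not> (j' = 0 \<and> c' < k)\<close>] obtain d' i' where
        d': "i' < len d'" "F c' + k * j' = F d' + k * Suc i'"
          "if j' = 0 then c' = d' + k \<and> Suc i' = len d' else c' = d' \<and> j' = Suc i'" by blast
      have "F d + k * i = v - k" using d(2) less.prems(3) by simp
      moreover have "F d' + k * i' = v - k" using d'(2) less.prems(4) by simp
      moreover have "v - k < v" using False k by simp
      ultimately have "d = d' \<and> i = i'" using less.IH d(1) d'(1) by blast
      \<comment> \<open>Whether \<open>Suc i\<close> equals \<open>len d\<close> decides which move
        was made, so equal predecessors force equal indices.\<close>
      then show ?thesis using d(3) d'(3) less.prems(1,2)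
        by (cases "j = 0"; cases "j' = 0"; simp)
    qed
  qed
  show ?thesis
  proof (rule bij_betw_imageI)
    show "inj_on (\<lambda>(c, j). F c + k * j) (SIGMA c:UNIV. {..<len c})"
      by (rule inj_onI) (use inj in \<open>auto split: prod.splits\<close>)
    show "(\<lambda>(c, j). F c + k * j) ` (SIGMA c:UNIV. {..<len c}) = UNIV"
    proof (rule UNIV_eq_I[symmetric])
      fix v
      obtain c j where "j < len c" "F c + k * j = v" using surj by blast
      then show "v \<in> (\<lambda>(c, j). F c + k * j) ` (SIGMA c:UNIV. {..<len c})"
        by (intro image_eqI[of _ _ "(c, j)"]) auto
    qed
  qed
qed

text \<open>A value \<open>v \<ge> k\<close> starts a block exactly when \<open>v - k\<close> ends
  one, and \<open>L c\<close> lies \<open>k\<close> past the end of block \<open>c\<close>; values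
  below \<open>k\<close> can only be starts.\<close>

lemma progressions_starts_and_ends:
  fixes F len :: "nat \<Rightarrow> nat" and k :: nat
  assumes k: "k > 0" and len: "\<And>c. len c > 0"
    and bij: "bij_betw (\<lambda>(c, j). F c + k * j) (SIGMA c:UNIV. {..<len c}) UNIV"
  defines "L \<equiv> \<lambda>c. F c + k * len c"
  shows "inj F" and "inj L" and "range F = {..<k} \<union> range L" and "k \<le> L c"
proof -
  have inj: "c = c' \<and> j = j'"
    if "F c + k * j = F c' + k * j'" "j < len c" "j' < len c'" for c j c' j'
    using inj_onD[OF bij_betw_imp_inj_on[OF bij], of "(c, j)" "(c', j')"] that by simp
  have surj: "\<exists>c j. j < len c \<and> F c + k * j = v" for v
  proof -
    have "v \<in> (\<lambda>(c, j). F c + k * j) ` (SIGMA c:UNIV. {..<len c})"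
      using bij by (simp add: bij_betw_def)
    then show ?thesis by auto
  qed
  have L_last: "L c = F c + k * (len c - 1) + k" for c
    using len[of c] by (cases "len c") (auto simp: L_def)
  show "inj F" using inj[of _ 0 _ 0] len by (auto intro: injI)
  show "inj L"
  proof (rule injI)
    fix c d assume "L c = L d"
    then show "c = d" using inj[of c "len c - 1" d "len d - 1"] len L_last by simp
  qed
  show "k \<le> L c" for c using L_last by simp
  have "F c \<in> {..<k} \<union> range L" for c
  proof (cases "F c < k")
    case False
    obtain d j where dj: "j < len d" "F d + k * j = F c - k" using surj by blast
    have "Suc j = len d"
    proof (rule ccontr)
      assume "Suc j \<noteq> len d"
      then have "Suc j < len d" using dj(1) by simp
      moreover have "F d + k * Suc j = F c + k * 0" using dj(2) False by simp
      ultimately have "Suc j = 0" using inj len by blast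
      then show False by simp
    qed
    then have "F c = L d" using dj False by (simp add: L_def flip: \<open>Suc j = len d\<close>)
    then show ?thesis by blast
  qed simp
  moreover have "v \<in> range F" if v: "v \<in> {..<k} \<union> range L" for v
  proof -
    obtain d j where dj: "j < len d" "F d + k * j = v" using surj by blast
    \<comment> \<open>If \<open>j > 0\<close>, then \<open>v - k\<close> is a non-final member of
      block \<open>d\<close>, while \<open>v = L c\<close> makes it the end of block
      \<open>c\<close>.\<close>
    have "j = 0"
    proof (rule ccontr)
      assume "j \<noteq> 0"
      then obtain i where i: "j = Suc i" by (cases j) auto
      with dj have "\<not> v < k" by auto
      then obtain c where "v = L c" using v by auto
      then have "F c + k * (len c - 1) = F d + k * i" "i < len d"
        using L_last[of c] dj i by simp_all
      then have "c = d \<and> len c - 1 = i" by (intro inj) (use len[of c] in simp_all)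
      then show False using dj i by auto
    qed
    then show ?thesis using dj by auto
  qed
  ultimately show "range F = {..<k} \<union> range L" by blast
qed

text \<open>Both sides are compared by counting the elements of the range of $F$ below $L(c)$.\<close>

lemma eventually_shift:
  fixes F L :: "nat \<Rightarrow> nat" and k :: nat
  assumes inj: "inj F" "inj L" and range: "range F = {..<k} \<union> range L"
    and L_ge: "\<And>c. k \<le> L c"
    and F_mono: "eventually (\<lambda>c. \<forall>d<c. F d < F c) sequentially"
    and L_mono: "eventually (\<lambda>c. \<forall>d<c. L d < L c) sequentially"
  shows "eventually (\<lambda>c. F (c + k) = L c) sequentially"
proof -
  \<comment> \<open>From \<open>C\<close> on, \<open>H c\<close> exceeds all earlier values and
    stays below all later ones, so exactly \<open>c\<close> values lie below it.\<close>
  have count: "card {v \<in> range H. v < H c} = c"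
    if "inj H" "\<And>c. c \<ge> C \<Longrightarrow> \<forall>d<c. H d < H c" "c \<ge> C" for H :: "nat \<Rightarrow> nat" and c C
  proof -
    have "H d < H c \<longleftrightarrow> d < c" for d
      using that(2)[of c] that(2)[of d] that(3)
      by (metis less_trans not_less_iff_gr_or_eq order.strict_implies_order order_trans)
    then have "{v \<in> range H. v < H c} = H ` {..<c}" by auto
    then show ?thesis using \<open>inj H\<close> by (simp add: card_image inj_on_subset[of H UNIV])
  qed
  obtain C1 where C1: "\<And>c. c \<ge> C1 \<Longrightarrow> \<forall>d<c. F d < F c"
    using F_mono by (auto simp: eventually_sequentially)
  obtain C2 where C2: "\<And>c. c \<ge> C2 \<Longrightarrow> \<forall>d<c. L d < L c"
    using L_mono by (auto simp: eventually_sequentially)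
  \<comment> \<open>From here on \<open>L c\<close> exceeds every \<open>F d\<close> with
    \<open>d \<le> C1\<close>, so the index of \<open>L c\<close> under \<open>F\<close> falls where
    counting is valid.\<close>
  define C where "C = C2 + Suc (Max (F ` {..C1}))"
  have growth: "i \<le> L (C2 + i)" for i
  proof (induction i)
    case (Suc i)
    have "L (C2 + i) < L (C2 + Suc i)" using C2[of "C2 + Suc i"] by simp
    then show ?case using Suc by simp
  qed simp
  have "F (c + k) = L c" if c: "c \<ge> C" for c
  proof -
    obtain d where d: "L c = F d" using range by (metis UnCI rangeE rangeI)
    have "C1 \<le> d"
    proof (rule ccontr)
      assume "\<not> C1 \<le> d"
      then have "F d \<le> Max (F ` {..C1})" by (intro Max_ge) auto
      moreover have "Suc (Max (F ` {..C1})) \<le> c - C2" using c C_def by simp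
      moreover have "c - C2 \<le> L c" using growth[of "c - C2"] c C_def by simp
      ultimately show False using d by simp
    qed
    \<comment> \<open>Counting the values of \<open>F\<close> below \<open>L c\<close> in two ways
      gives \<open>d = k + c\<close>.\<close>
    have "d = card {v \<in> range F. v < L c}" using count[OF inj(1) C1 \<open>C1 \<le> d\<close>] d by simp
    also have "{v \<in> range F. v < L c} = {..<k} \<union> {v \<in> range L. v < L c}"
      using range L_ge[of c] by auto
    also have "card \<dots> = k + card {v \<in> range L. v < L c}"
    proof (subst card_Un_disjoint)
      show "{..<k} \<inter> {v \<in> range L. v < L c} = {}"
        using L_ge by (auto dest: leD)
    qed simp_all
    also have "card {v \<in> range L. v < L c} = c"
      using count[OF inj(2) C2] c C_def by simp
    finally show ?thesis using d by (simp add: add.commute)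
  qed
  then show ?thesis by (auto simp: eventually_sequentially)
qed

text \<open>\<open>h c - h d\<close> is \<open>(c - d) * (A * (c + d) + B)\<close> plus an error of
  size at most \<open>2 * E\<close>; the first factor is at least 1 and the second exceeds
  \<open>2 * E\<close> once \<open>c\<close> is large.\<close>

lemma quadratic_eventually_mono:
  fixes h e :: "nat \<Rightarrow> real" and A B E :: real
  assumes "A > 0" and h: "\<And>c. h c = A * (real c)\<^sup>2 + B * real c + e c"
    and e: "\<And>c. \<bar>e c\<bar> \<le> E"
  shows "eventually (\<lambda>c. \<forall>d<c. h d < h c) sequentially"
proof -
  obtain C where C: "(2 * E - B) / A < real C" using reals_Archimedean2 by blast
  have "h d < h c" if "c \<ge> C" "d < c" for c d
  proof -
    have "(2 * E - B) / A < real c" using C that by linarith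
    then have *: "2 * E < A * real c + B" using \<open>A > 0\<close> by (simp add: field_simps)
    have "E \<ge> 0" using e[of 0] by linarith
    have "A * real c + B \<le> A * (real c + real d) + B" using \<open>A > 0\<close> by simp
    also have "\<dots> \<le> (real c - real d) * (A * (real c + real d) + B)"
    proof -
      have "1 \<le> real c - real d" using that by linarith
      moreover have "0 \<le> A * (real c + real d) + B"
        using * \<open>E \<ge> 0\<close> \<open>A > 0\<close> by (simp add: distrib_left add_nonneg_nonneg add.assoc)
          (smt (verit) mult_nonneg_nonneg of_nat_0_le_iff)
      ultimately show ?thesis using mult_right_mono by fastforce
    qed
    finally have "2 * E < (real c - real d) * (A * (real c + real d) + B)" using * by simp
    also have "\<dots> = h c - h d - (e c - e d)"
      by (simp add: h algebra_simps power2_eq_square)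
    finally show ?thesis using e[of c] e[of d] by linarith
  qed
  then show ?thesis by (auto simp: eventually_sequentially)
qed

section \<open>Stairs\<close>

text \<open>The divisibility hypothesis enters as \<open>l = N * q\<close>, and \<open>Suc\<close>
  avoids truncated subtraction in \<open>m - 1\<close>.\<close>

locale staircases =
  fixes n m l N M q :: nat
  assumes n: "n = l * N" and m: "m = Suc (l * M)" and l: "l = N * q"
    and N: "N > 0" and q: "q > 0" and coprime: "coprime N M"
begin

section \<open>Arithmetic of the staircases modulo N\<close>

lemma gcd: "gcd n (m - 1) = l"
  using coprime by (simp add: n m gcd_mult_left)

lemma l_pos: "l > 0"
  using N q by (simp add: l)

text \<open>On the line \<open>N * x - M * y = c\<close> an integral \<open>y\<close> has an
  integral \<open>x\<close> exactly when this divisibility holds.\<close>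

definition first_y :: "nat \<Rightarrow> nat" where
  "first_y c = (LEAST y. N dvd c + M * y)"

lemma first_y_less: "first_y c < N" and first_y_dvd: "N dvd c + M * first_y c"
proof -
  obtain x where x: "[M * x = 1] (mod N)"
    using cong_solve_coprime_nat[of M N] coprime by (auto simp: coprime_commute)
  \<comment> \<open>\<open>x\<close> inverts \<open>M\<close> modulo \<open>N\<close> and
    \<open>N - 1\<close> stands for -1, so this \<open>y\<close> solves the congruence.\<close>
  define y where "y = x * (c * (N - 1)) mod N"
  have "[M * y = M * (x * (c * (N - 1)))] (mod N)"
    unfolding y_def by (intro cong_mult) simp_all
  also have "[M * (x * (c * (N - 1))) = c * (N - 1)] (mod N)"
    using cong_mult[OF x cong_refl[of "c * (N - 1)"]] by (simp add: mult.assoc)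
  finally have "[c + M * y = c + c * (N - 1)] (mod N)" by (intro cong_add) simp_all
  also have "c + c * (N - 1) = N * c"
    using N by (cases N) (simp_all add: algebra_simps)
  finally have "[c + M * y = N * c] (mod N)" .
  then have y: "N dvd c + M * y" by (simp add: cong_def mod_eq_0_iff_dvd)
  show "N dvd c + M * first_y c" unfolding first_y_def using y by (rule LeastI)
  have "first_y c \<le> y" unfolding first_y_def using y by (rule Least_le)
  also have "y < N" using N by (simp add: y_def)
  finally show "first_y c < N" .
qed

lemma dvd_iff_first_y: "N dvd c + M * y \<longleftrightarrow> y mod N = first_y c"
proof
  assume "N dvd c + M * y"
  then have "[c + M * y = c + M * first_y c] (mod N)"
    using first_y_dvd[of c] by (simp add: cong_def mod_eq_0_iff_dvd)
  then have "[y = first_y c] (mod N)"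
    using coprime by (simp add: cong_add_lcancel_nat cong_mult_lcancel_nat coprime_commute)
  then show "y mod N = first_y c" using first_y_less by (simp add: cong_def)
next
  assume y: "y mod N = first_y c"
  have "c + M * y = c + M * first_y c + N * (M * (y div N))"
    unfolding y[symmetric] by (metis add.assoc add_mult_distrib2 mod_mult_div_eq mult.left_commute)
  then show "N dvd c + M * y" using first_y_dvd by (metis dvd_add dvd_triv_left)
qed

lemma first_y_eqI: "N dvd c + M * y \<Longrightarrow> y < N \<Longrightarrow> first_y c = y"
  using dvd_iff_first_y by simp

lemma first_y_eq_0_iff: "first_y c = 0 \<longleftrightarrow> N dvd c"
  using dvd_iff_first_y[of c 0] by auto

lemma first_y_add_mult: "first_y (c + N * t) = first_y c"
proof (rule first_y_eqI)
  have "c + N * t + M * first_y c = c + M * first_y c + N * t" by simp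
  then show "N dvd c + N * t + M * first_y c" using first_y_dvd by (metis dvd_add dvd_triv_left)
qed (rule first_y_less)

text \<open>The excess over $c l$ of the $y$-coordinate of the first lattice point of the $c$-th line
  beyond the sector.\<close>

definition excess :: "nat \<Rightarrow> nat" where
  "excess c = (if first_y c = 0 then N else first_y c)"

lemma excess_pos: "1 \<le> excess c" and excess_le: "excess c \<le> N"
  using N first_y_less[of c] by (auto simp: excess_def)

lemma dvd_excess: "N dvd c + M * excess c"
  using first_y_dvd[of c] first_y_eq_0_iff[of c] by (auto simp: excess_def)

text \<open>The number of stairs: as \<open>c * l = c * q * N\<close>, each residue class modulo
  \<open>N\<close> has \<open>c * q\<close> members below \<open>c * l\<close>, and
  \<open>c * l\<close> itself is one more in the class of 0.\<close>

definition len :: "nat \<Rightarrow> nat" where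
  "len c = c * q + (if first_y c = 0 then 1 else 0)"

lemma len_eq: "first_y c + len c * N = c * l + excess c"
  by (simp add: len_def excess_def l algebra_simps)

lemma len_pos: "len c > 0"
  using q first_y_eq_0_iff[of 0] by (cases "c = 0") (auto simp: len_def)

lemma less_len_iff: "j < len c \<longleftrightarrow> first_y c + j * N \<le> c * l"
proof
  assume "j < len c"
  then have "Suc j * N \<le> len c * N" by (intro mult_le_mono1) simp
  then show "first_y c + j * N \<le> c * l" using len_eq[of c] excess_le[of c] by simp
next
  assume "first_y c + j * N \<le> c * l"
  then have "j * N < len c * N" using len_eq[of c] excess_pos[of c] by linarith
  then show "j < len c" by simp
qed

section \<open>Parametrization of the stairs and of the lattice points of the sector\<close>

text \<open>The index \<open>j\<close> is not cut off at \<open>len c\<close>. With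
  \<open>div\<close> integrality is evident; by \<open>stair_eq\<close> the division is
  exact.\<close>

definition stair :: "nat \<Rightarrow> nat \<Rightarrow> real \<times> real" where
  "stair c j = (real ((c + M * (first_y c + j * N)) div N), real (first_y c + j * N))"

lemma stair_eq:
  "stair c j = ((real c + real M * real (first_y c + j * N)) / real N, real (first_y c + j * N))"
proof -
  have "N dvd c + M * (first_y c + j * N)"
    using dvd_iff_first_y first_y_less by simp
  then show ?thesis by (simp add: stair_def real_of_nat_div)
qed

lemma stair_line: "real N * fst (stair c j) - real M * snd (stair c j) = real c"
  using N by (simp add: stair_eq)

lemma stair_eq_iff: "stair c i = stair d j \<longleftrightarrow> c = d \<and> i = j"
proof
  assume eq: "stair c i = stair d j"
  then have "real c = real d" using stair_line[of c i] stair_line[of d j] by simp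
  then show "c = d \<and> i = j" using eq N by (simp add: stair_def)
qed simp

text \<open>With \<open>n * x = l * (c + M * y)\<close> and \<open>m = 1 + l * M\<close>, the term
  \<open>l * M * y\<close> cancels from \<open>m * y \<le> n * x\<close> and leaves
  \<open>y \<le> c * l\<close>.\<close>

lemma mem_staircase_iff:
  "(x, y) \<in> staircase n m c \<longleftrightarrow>
     0 \<le> y \<and> y \<le> real c * real l \<and> real N * x - real M * y = real c"
proof -
  have [simp]: "real l > 0" "real N > 0" using l_pos N by simp_all
  have line: "real n * x - (real m - 1) * y = real c * real (gcd n (m - 1)) \<longleftrightarrow>
      real N * x - real M * y = real c"
  proof -
    have "real n * x - (real m - 1) * y = real l * (real N * x - real M * y)"
      by (simp add: n m algebra_simps)
    then show ?thesis unfolding gcd using l_pos by (simp add: mult.commute[of "real c"])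
  qed
  have "0 \<le> x \<and> y \<le> real n / real m * x \<longleftrightarrow> y \<le> real c * real l"
    if "0 \<le> y" and on_line: "real N * x - real M * y = real c"
  proof -
    have "real N * x = real c + real M * y" using on_line by simp
    moreover have "\<dots> \<ge> 0" using \<open>0 \<le> y\<close> by simp
    ultimately have "0 \<le> x" by (metis \<open>real N > 0\<close> zero_le_mult_iff not_less)
    have m_pos: "0 < real m" by (simp only: m of_nat_0_less_iff zero_less_Suc)
    have "y \<le> real n / real m * x \<longleftrightarrow> y * real m \<le> real n * x"
      using pos_le_divide_eq[OF m_pos, of y "real n * x"] by simp
    also have "real n * x = real l * (real c + real M * y)"
      using \<open>real N * x = _\<close> by (simp add: n)
    also have "y * real m \<le> \<dots> \<longleftrightarrow> y \<le> real c * real l"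
      by (simp add: m algebra_simps)
    finally show ?thesis using \<open>0 \<le> x\<close> by simp
  qed
  then show ?thesis unfolding staircase_def sector_def mem_Collect_eq case_prod_conv line by auto
qed

lemma stairs_on_eq: "stairs_on n m c = stair c ` {..<len c}"
proof (intro equalityI subsetI)
  fix p assume "p \<in> stairs_on n m c"
  then obtain x y where p: "p = (x, y)" "x \<in> \<int>" "y \<in> \<int>" "0 \<le> y" "y \<le> real c * real l"
    "real N * x - real M * y = real c"
    by (cases p) (auto simp: stairs_on_def mem_staircase_iff)
  then obtain b where b: "y = real b" by (metis Ints_cases of_int_0_le_iff nonneg_int_cases of_int_of_nat_eq)
  obtain a where a: "x = of_int a" using p by (auto elim: Ints_cases)
  have "real_of_int (int N * a) = real_of_int (int (c + M * b))" using p a b by simp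
  then have "int N * a = int (c + M * b)" by (simp only: of_int_eq_iff)
  then have "int N dvd int (c + M * b)" by (metis dvd_triv_left)
  then have "N dvd c + M * b" by (simp only: int_dvd_int_iff)
  then have "b mod N = first_y c" by (simp only: dvd_iff_first_y)
  then have b': "b = first_y c + (b div N) * N" by (metis mod_div_mult_eq)
  have "real b \<le> real (c * l)" using p b by simp
  then have "b \<le> c * l" by (simp only: of_nat_le_iff)
  then have "b div N < len c" unfolding less_len_iff by (simp flip: b')
  moreover have "x = (real c + real M * real b) / real N" using p b N by (simp add: field_simps)
  then have "p = stair c (b div N)" unfolding stair_eq using p b by (simp flip: b')
  ultimately show "p \<in> stair c ` {..<len c}" by blast
next
  fix p assume "p \<in> stair c ` {..<len c}"
  then obtain j where j: "j < len c" and p: "p = stair c j" by auto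
  have "real (first_y c + j * N) \<le> real (c * l)" using j less_len_iff by (simp only: of_nat_le_iff)
  then have "p \<in> staircase n m c"
    unfolding p stair_def mem_staircase_iff using stair_line[of c j] by (simp add: stair_def)
  then show "p \<in> stairs_on n m c" by (simp add: stairs_on_def p stair_def)
qed

text \<open>For \<open>M > 0\<close> the abscissa strictly increases with the index; for
  \<open>M = 0\<close> the staircases are vertical and the ordinate takes its place. Either way the
  minimizer is unique, which determines \<open>ARG_MIN\<close>.\<close>

lemma first_stair_eq: "first_stair n m c = stair c 0"
proof -
  have mem: "stair c 0 \<in> stairs_on n m c" using len_pos by (auto simp: stairs_on_eq)
  have fst_less: "fst (stair c 0) < fst (stair c j)" if "M > 0" "j > 0" for j
    using that N by (simp add: stair_eq divide_strict_right_mono)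
  have snd_less: "snd (stair c 0) < snd (stair c j)" if "j > 0" for j
    using that N by (simp add: stair_eq)
  have arg_min: "(ARG_MIN f s. s \<in> stairs_on n m c) = stair c 0"
    if less: "\<And>j. j > 0 \<Longrightarrow> f (stair c 0) < f (stair c j)" for f :: "real \<times> real \<Rightarrow> real"
  proof (rule arg_minI)
    show "\<not> f s < f (stair c 0)" if s: "s \<in> stairs_on n m c" for s
      proof -
        obtain j where "s = stair c j" using s by (auto simp: stairs_on_eq)
        then show ?thesis using less[of j] by (cases "j = 0") auto
      qed
    show "s = stair c 0"
      if s: "s \<in> stairs_on n m c" "\<forall>t. t \<in> stairs_on n m c \<longrightarrow> \<not> f t < f s" for s
      proof -
        obtain j where j: "s = stair c j" using s by (auto simp: stairs_on_eq)
        have "\<not> f (stair c 0) < f s" using s mem by blast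
        then show ?thesis using less[of j] j by (cases "j = 0") auto
      qed
  qed (rule mem)
  show ?thesis
    unfolding first_stair_def using arg_min[of fst] arg_min[of snd] fst_less snd_less
    using l_pos by (cases "M = 0") (simp_all add: m)
qed

lemma int_sector_eq: "int_sector (real n / real m) = (\<lambda>(c, j). stair c j) ` (SIGMA c:UNIV. {..<len c})"
proof -
  have "int_sector (real n / real m) = (\<Union>c. stairs_on n m c)"
  proof (intro equalityI subsetI)
    fix p assume "p \<in> int_sector (real n / real m)"
    then obtain a b where p: "p = (real_of_int a, real_of_int b)"
      and s: "p \<in> sector (real n / real m)"
      by (auto simp: int_sector_def elim!: Ints_cases)
    then have b: "0 \<le> b" and "real_of_int b \<le> real n / real m * a" by (auto simp: sector_def)
    moreover have "0 < real m" by (simp only: m of_nat_0_less_iff zero_less_Suc)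
    ultimately have "real m * b \<le> real n * a" by (simp add: pos_le_divide_eq mult.commute)
    then have "int m * b \<le> int n * a" by (metis of_int_le_iff of_int_mult of_int_of_nat_eq)
    \<comment> \<open>Rewritten with \<open>m = 1 + l * M\<close>, the sector inequality bounds
      \<open>b \<ge> 0\<close> by \<open>l\<close> times the staircase number, which is therefore
      not negative.\<close>
    then have "b \<le> int l * (int N * a - int M * b)" by (simp add: n m algebra_simps)
    then have "0 \<le> int N * a - int M * b" using b l_pos
      by (smt (verit) mult_pos_neg of_nat_0_less_iff)
    then obtain c where "int N * a - int M * b = int c" by (metis nonneg_int_cases)
    then have "real_of_int (int N * a - int M * b) = real c" by simp
    then have "real n * a - (real m - 1) * b = real c * real (gcd n (m - 1))"
      unfolding gcd by (simp add: n m algebra_simps flip: \<open>_ = real c\<close>)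
    then have "p \<in> stairs_on n m c" using s p by (simp add: stairs_on_def staircase_def)
    then show "p \<in> (\<Union>c. stairs_on n m c)" by blast
  qed (auto simp: int_sector_def stairs_on_def staircase_def)
  then show ?thesis by (fastforce simp: stairs_on_eq intro: rev_image_eqI)
qed

lemma packing_poly_iff:
  "packing_poly (real n / real m) p \<longleftrightarrow>
    bij_betw (\<lambda>(c, j). eval2 p (stair c j)) (SIGMA c:UNIV. {..<len c}) \<nat>"
proof -
  have "bij_betw (\<lambda>(c, j). stair c j) (SIGMA c:UNIV. {..<len c}) (int_sector (real n / real m))"
    unfolding int_sector_eq by (intro inj_on_imp_bij_betw inj_onI) (auto simp: stair_eq_iff)
  from bij_betw_comp_iff[OF this, of "eval2 p" \<nat>] show ?thesis
    unfolding packing_poly_def by (simp add: comp_def case_prod_unfold)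
qed

text \<open>Turns the Euclidean norm in the ascending condition into the index: both coordinates are
  nonnegative and weakly increasing in it, the ordinate strictly.\<close>

lemma norm_stair_less_iff: "norm (stair c i) < norm (stair c j) \<longleftrightarrow> i < j"
proof -
  have less: "norm (stair c i) < norm (stair c j)" if "i < j" for i j
  proof -
    have y_less: "real (first_y c + i * N) < real (first_y c + j * N)" using that N by simp
    have "real c + real M * real (first_y c + i * N) \<le>
        real c + real M * real (first_y c + j * N)"
      by (rule add_left_mono, rule mult_left_mono) (use less_imp_le[OF y_less] in simp_all)
    with y_less have "(fst (stair c i))\<^sup>2 \<le> (fst (stair c j))\<^sup>2" "(snd (stair c i))\<^sup>2 < (snd (stair c j))\<^sup>2"
      unfolding stair_eq by (auto intro!: power_mono power_strict_mono divide_right_mono simp del: of_nat_add)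
    then show ?thesis by (simp add: norm_prod_def)
  qed
  show ?thesis using less[of i j] less[of j i] by (cases i j rule: linorder_cases) auto
qed

text \<open>Staircase 0 is the origin alone. Staircase \<open>N\<close> starts at ordinate 0 and has
  \<open>N * q + 1\<close> stairs, so it supplies a pair from which the step of the polynomial can
  be read off.\<close>

lemma consecutive_stairs_0_1: "consecutive_stairs n m (stair N 0) (stair N 1)"
proof -
  have y0: "first_y N = 0" by (simp add: first_y_eq_0_iff)
  then have "1 < len N" using N q by (simp add: len_def)
  have "t = stair N 0 \<or> t = stair N 1"
    if t: "t \<in> stairs_on n m c" "t \<in> closed_segment (stair N 0) (stair N 1)" for c t
  proof -
    obtain j where j: "t = stair c j" using t by (auto simp: stairs_on_eq)
    obtain u where u: "0 \<le> u" "u \<le> 1" "t = (1 - u) *\<^sub>R stair N 0 + u *\<^sub>R stair N 1"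
      using t by (auto simp: closed_segment_def)
    \<comment> \<open>\<open>N * x - M * y\<close> is affine and equals \<open>N\<close> at both
      ends of the segment, so \<open>t\<close> lies on staircase \<open>N\<close>.\<close>
    have "real c = real N * fst t - real M * snd t" using j stair_line by simp
    also have "\<dots> = (1 - u) * (real N * fst (stair N 0) - real M * snd (stair N 0)) +
        u * (real N * fst (stair N 1) - real M * snd (stair N 1))"
      unfolding u by (simp add: algebra_simps)
    also have "\<dots> = real N" unfolding stair_line by (simp add: algebra_simps)
    finally have c: "c = N" by simp
    have "real (j * N) = snd t" using j c y0 by (simp add: stair_def)
    also have "\<dots> = u * real N" using u y0 by (simp add: stair_def)
    finally have "j \<le> 1" using u N by simp
    then show ?thesis using j c by (cases j) auto
  qed
  then show ?thesis
    unfolding consecutive_stairs_def using \<open>1 < len N\<close> by (auto simp: stairs_on_eq stair_eq_iff intro!: exI[of _ N])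
qed

lemma consecutive_stairsE:
  assumes "consecutive_stairs n m r s"
  obtains c i j where "r = stair c i" "s = stair c j"
  using assms unfolding consecutive_stairs_def stairs_on_eq by blast

section \<open>Values of the polynomial along the staircases\<close>

text \<open>The linear form under the square is constant on a staircase, namely
  \<open>c / N\<close>, so \<open>g\<close> is affine in the ordinate and changes by
  \<open>a * M + b * N\<close> per index step.\<close>

lemma eval_stair:
  fixes g :: "real \<times> real \<Rightarrow> real"
  assumes g: "\<And>x y. g (x, y) =
      real n / 2 * (x - (real m - 1) / real n * y)\<^sup>2 + a * x + b * y + f"
  shows "g (stair c j) = (real l / 2 * (real c)\<^sup>2 + a * real c +
      (a * real M + b * real N) * real (first_y c + j * N)) / real N + f"
proof -
  obtain x y where xy: "stair c j = (x, y)" by (cases "stair c j")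
  then have y: "y = real (first_y c + j * N)" by (simp add: stair_def)
  have line: "real N * x - real M * y = real c" using stair_line[of c j] xy by simp
  have pos: "real N > 0" "real l > 0" using N l_pos by simp_all
  have "x - (real m - 1) / real n * y = (real N * x - real M * y) / real N"
    using pos by (simp add: n m field_simps)
  then have sq: "real n / 2 * (x - (real m - 1) / real n * y)\<^sup>2 = real l / 2 * (real c)\<^sup>2 / real N"
    unfolding line using pos by (simp add: n power2_eq_square)
  have "x = (real c + real M * y) / real N" using line pos by (simp add: field_simps)
  then have "a * x + b * y = (a * real c + (a * real M + b * real N) * y) / real N"
    using pos by (simp add: field_simps)
  then show ?thesis unfolding xy g sq y[symmetric] by (simp add: add_divide_distrib)
qed

text \<open>The \<open>F\<close> of the outline as a real number, with the coefficient of
  \<open>y\<close> eliminated through \<open>a * M + b * N = k\<close>.\<close>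

definition start :: "real \<Rightarrow> real \<Rightarrow> nat \<Rightarrow> nat \<Rightarrow> real" where
  "start a f k c = (real l / 2 * (real c)\<^sup>2 + a * real c + real k * real (first_y c)) / real N + f"

lemma eval_stair_start:
  assumes "\<And>x y. g (x, y) =
      real n / 2 * (x - (real m - 1) / real n * y)\<^sup>2 + a * x + b * y + f"
    and "a * real M + b * real N = real k"
  shows "g (stair c j) = start a f k c + real k * real j"
  unfolding eval_stair[OF assms(1)] assms(2) start_def using N by (simp add: field_simps)

text \<open>The \<open>L\<close> of the outline: by \<open>len_eq\<close>, running through all
  stairs replaces the ordinate \<open>first_y c\<close> by \<open>c * l + excess c\<close>.\<close>

lemma start_add_len:
  "start a f k c + real k * real (len c) =
    (real l / 2 * (real c)\<^sup>2 + (a + real k * real l) * real c + real k * real (excess c)) / real N + f"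
proof -
  have "real (first_y c) + real (len c) * real N = real c * real l + real (excess c)"
    using len_eq[of c] by (simp only: flip: of_nat_add of_nat_mult)
  then have "real k * real (first_y c) + real k * real (len c) * real N =
      real k * real c * real l + real k * real (excess c)"
    by (simp only: mult.assoc flip: distrib_left)
  then show ?thesis unfolding start_def using N by (simp add: field_simps)
qed

text \<open>The terms quadratic and linear in \<open>c\<close> cancel, and what remains is
  \<open>k / N\<close> times the discrepancy in the second equation.\<close>

lemma start_shift_iff:
  assumes "k > 0"
  shows "start a f k (c + k) = start a f k c + real k * real (len c) \<longleftrightarrow>
    real (excess c) - real (first_y (c + k)) = a + real k * real l / 2"
proof -
  have "start a f k (c + k) - (start a f k c + real k * real (len c)) =
      real k * (a + real k * real l / 2 - (real (excess c) - real (first_y (c + k)))) / real N"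
    unfolding start_add_len unfolding start_def
    using N by (simp add: field_simps power2_eq_square)
  also have "\<dots> = 0 \<longleftrightarrow> real (excess c) - real (first_y (c + k)) = a + real k * real l / 2"
    using assms N by auto
  finally show ?thesis by simp
qed

text \<open>Adding \<open>k\<close> to \<open>c\<close> adds \<open>M\<close> modulo
  \<open>N\<close>, which lowering the ordinate by one compensates. As \<open>excess c\<close> lies
  in 1, ..., \<open>N\<close>, the lowered ordinate is already reduced.\<close>

lemma first_y_shift:
  assumes "[k = M] (mod N)"
  shows "Suc (first_y (c + k)) = excess c"
proof -
  have "first_y (c + k) = excess c - 1"
  proof (rule first_y_eqI)
    have "[c + k + M * (excess c - 1) = c + M + M * (excess c - 1)] (mod N)"
      using assms by (intro cong_add) simp_all
    also have "c + M + M * (excess c - 1) = c + M * excess c"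
      using excess_pos[of c] by (cases "excess c") auto
    finally show "N dvd c + k + M * (excess c - 1)"
      using dvd_excess[of c] by (simp add: cong_dvd_iff)
    show "excess c - 1 < N" using excess_pos[of c] excess_le[of c] by simp
  qed
  then show ?thesis using excess_pos[of c] by simp
qed

lemma shift_imp_parameters:
  assumes "k > 0"
    and "eventually (\<lambda>c. start a f k (c + k) = start a f k c + real k * real (len c)) sequentially"
  shows "a = 1 - real k * real l / 2" and "[k = M] (mod N)"
proof -
  define A where "A = a + real k * real l / 2"
  obtain C where C: "\<And>c. c \<ge> C \<Longrightarrow> real (excess c) - real (first_y (c + k)) = A"
    using assms by (auto simp: eventually_sequentially start_shift_iff A_def)
  \<comment> \<open>Both functions have period \<open>N\<close> in \<open>c\<close>, so the eventual
    identity holds everywhere.\<close>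
  have A: "real (excess c) - real (first_y (c + k)) = A" for c
  proof -
    have "c + N * C \<ge> C" using N by (simp add: trans_le_add2)
    moreover have "excess (c + N * C) = excess c" by (simp add: excess_def first_y_add_mult)
    moreover have "first_y (c + N * C + k) = first_y (c + k)"
      using first_y_add_mult[of "c + k" C] by (simp add: ac_simps)
    ultimately show ?thesis using C by metis
  qed
  \<comment> \<open>This choice of \<open>c\<close> makes \<open>c + k\<close> a multiple of
    \<open>N\<close>, so the subtracted ordinate is 0.\<close>
  have "k * (N - 1) + k = N * k" using N by (cases N) auto
  then have "first_y (k * (N - 1) + k) = 0" by (simp add: first_y_eq_0_iff)
  then have "A \<ge> 1" using A[of "k * (N - 1)"] excess_pos[of "k * (N - 1)"] by simp
  moreover have "A \<le> 1"
  proof -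
    \<comment> \<open>This choice of \<open>c\<close> makes \<open>c + M\<close> a multiple of
      \<open>N\<close>, so the excess takes its least value 1.\<close>
    have "M * (N - 1) + M * 1 = N * M" using N by (cases N) auto
    then have "1 mod N = first_y (M * (N - 1))" by (metis dvd_iff_first_y dvd_triv_left)
    then have "excess (M * (N - 1)) = 1"
      using N excess_pos[of "M * (N - 1)"] excess_le[of "M * (N - 1)"]
      by (cases "N = 1") (simp_all add: excess_def)
    then show ?thesis using A[of "M * (N - 1)"] by simp
  qed
  ultimately have "A = 1" by simp
  then show "a = 1 - real k * real l / 2" by (simp add: A_def)
  \<comment> \<open>At \<open>c = 0\<close> the excess is \<open>N\<close>, so
    \<open>first_y k = N - 1\<close>, which is -1 modulo \<open>N\<close>; its defining divisibility
    then reads \<open>k - M = 0\<close> modulo \<open>N\<close>.\<close>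
  have "first_y 0 = 0" by (simp add: first_y_eq_0_iff)
  then have "real N - real (first_y k) = 1" using A[of 0] \<open>A = 1\<close> by (simp add: excess_def)
  then have "N = Suc (first_y k)" by linarith
  then have "M * N = M * Suc (first_y k)" by (rule arg_cong)
  then have "k + M * N = k + M * first_y k + M" by simp
  moreover have "[k + M * first_y k + M = 0 + M] (mod N)"
    using first_y_dvd[of k] by (intro cong_add) (simp_all add: cong_0_iff)
  ultimately have "[k + M * N = M] (mod N)" by (simp only: add_0)
  then show "[k = M] (mod N)" by (simp add: cong_def)
qed

lemma abs_first_y_le: "\<bar>real k * real (first_y c) / real N + f\<bar> \<le> real k + \<bar>f\<bar>"
  and abs_excess_le: "\<bar>real k * real (excess c) / real N + f\<bar> \<le> real k + \<bar>f\<bar>"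
proof -
  have bound: "\<bar>real k * real y / real N + f\<bar> \<le> real k + \<bar>f\<bar>" if "y \<le> N" for y
  proof -
    have "real k * real y / real N \<le> real k * real N / real N"
      using that by (intro divide_right_mono mult_left_mono) simp_all
    then have "real k * real y / real N \<le> real k" using N by simp
    moreover have "0 \<le> real k * real y / real N" by simp
    ultimately show ?thesis by linarith
  qed
  show "\<bar>real k * real (first_y c) / real N + f\<bar> \<le> real k + \<bar>f\<bar>"
    using first_y_less[of c] by (intro bound) simp
  show "\<bar>real k * real (excess c) / real N + f\<bar> \<le> real k + \<bar>f\<bar>"
    using excess_le[of c] by (rule bound)
qed

lemma start_eventually_mono:
  "eventually (\<lambda>c. \<forall>d<c. start a f k d < start a f k c) sequentially"
proof (rule quadratic_eventually_mono)
  show "start a f k c = real l / 2 / real N * (real c)\<^sup>2 + a / real N * real c +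
      (real k * real (first_y c) / real N + f)" for c
    by (simp add: start_def add_divide_distrib)
qed (use l_pos N abs_first_y_le in auto)

lemma start_add_len_eventually_mono:
  "eventually (\<lambda>c. \<forall>d<c. start a f k d + real k * real (len d) <
    start a f k c + real k * real (len c)) sequentially"
proof (rule quadratic_eventually_mono)
  show "start a f k c + real k * real (len c) = real l / 2 / real N * (real c)\<^sup>2 +
      (a + real k * real l) / real N * real c + (real k * real (excess c) / real N + f)" for c
    by (simp add: start_add_len add_divide_distrib distrib_right)
qed (use l_pos N abs_excess_le in auto)

section \<open>The packing criterion in terms of start values and lengths\<close>

lemma packing_iff:
  assumes "k > 0"
  shows "bij_betw (\<lambda>(c, j). start a f k c + real k * real j) (SIGMA c:UNIV. {..<len c}) \<nat> \<longleftrightarrow>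
    a = 1 - real k * real l / 2 \<and> [k = M] (mod N) \<and> start a f k ` {..<k} = real ` {..<k}"
    (is "?packing \<longleftrightarrow> ?params")
proof -
  let ?\<Sigma> = "SIGMA c:UNIV. {..<len c}"
  have nat_iff: "?packing \<longleftrightarrow> bij_betw (\<lambda>(c, j). F c + k * j) ?\<Sigma> UNIV"
    if F: "\<And>c. start a f k c = real (F c)" for F
  proof -
    have "bij_betw real UNIV \<nat>" by (simp add: bij_betw_def Nats_def inj_on_def)
    from bij_betw_comp_iff2[OF this, of "\<lambda>(c, j). F c + k * j" ?\<Sigma>]
    show ?thesis by (simp add: F comp_def case_prod_unfold)
  qed
  show ?thesis
  proof
    assume packing: ?packing
    have "start a f k c \<in> \<nat>" for c
    proof -
      have "(\<lambda>(c, j). start a f k c + real k * real j) (c, 0) \<in> \<nat>"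
        by (rule bij_betwE[OF packing, rule_format]) (use len_pos in auto)
      then show ?thesis by simp
    qed
    then have "\<forall>c. \<exists>v. start a f k c = real v" by (auto simp: Nats_def)
    then obtain F where F: "\<And>c. start a f k c = real (F c)" by metis
    have bij: "bij_betw (\<lambda>(c, j). F c + k * j) ?\<Sigma> UNIV" using nat_iff[OF F] packing by simp
    define L where "L c = F c + k * len c" for c
    have L: "start a f k c + real k * real (len c) = real (L c)" for c by (simp add: F L_def)
    note props = progressions_starts_and_ends[OF assms len_pos bij, folded L_def]
    have "eventually (\<lambda>c. F (c + k) = L c) sequentially"
      using props start_eventually_mono[of a f k] start_add_len_eventually_mono[of a f k]
      unfolding L unfolding F by (intro eventually_shift) simp_all
    then have "eventually (\<lambda>c. start a f k (c + k) = start a f k c + real k * real (len c)) sequentially"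
      unfolding L unfolding F by simp
    note params = shift_imp_parameters[OF assms this]
    \<comment> \<open>The parameters, found from large \<open>c\<close>, give the shift identity
      back for every \<open>c\<close>.\<close>
    have "start a f k (c + k) = start a f k c + real k * real (len c)" for c
      unfolding start_shift_iff[OF assms] using first_y_shift[OF params(2), of c] params(1) by simp
    then have shift: "F (c + k) = L c" for c unfolding L unfolding F by simp
    \<comment> \<open>The starts from index \<open>k\<close> on are the values of \<open>L\<close>;
      removing them from the range of \<open>F\<close> leaves the numbers below
      \<open>k\<close>.\<close>
    have "F ` {..<k} = range F - F ` {k..}"
      using props(1) by (subst image_set_diff[symmetric]) auto
    also have "{k..} = range (\<lambda>c. c + k)" by (auto simp: image_iff le_iff_add add.commute)
    then have "F ` {k..} = range L" using shift by (simp add: image_image)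
    also have "range F - range L = {..<k}"
      using props(3,4) by (auto dest: leD)
    finally have "F ` {..<k} = {..<k}" .
    then have "start a f k ` {..<k} = real ` {..<k}" by (simp add: F flip: image_image[of real F])
    with params show ?params by simp
  next
    assume params: ?params
    then have shift: "start a f k (c + k) = start a f k c + real k * real (len c)" for c
      unfolding start_shift_iff[OF assms] using first_y_shift[of k c] by simp
    \<comment> \<open>Integrality spreads from the first \<open>k\<close> starts to all others along
      the shift.\<close>
    have "start a f k c \<in> \<nat>" for c
    proof (induction c rule: less_induct)
      case (less c)
      show ?case
      proof (cases "c < k")
        case True
        then have "start a f k c \<in> real ` {..<k}" using params by blast
        then show ?thesis by auto
      next
        case False
        then show ?thesis using shift[of "c - k"] less[of "c - k"] assms by simp
      qed
    qed
    then have "\<forall>c. \<exists>v. start a f k c = real v" by (auto simp: Nats_def)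
    then obtain F where F: "\<And>c. start a f k c = real (F c)" by metis
    have "real (F (c + k)) = real (F c + k * len c)" for c using shift[of c] by (simp add: F)
    then have "F (c + k) = F c + k * len c" for c by (simp only: of_nat_eq_iff)
    moreover have "real ` F ` {..<k} = real ` {..<k}" using params by (simp add: F image_image)
    then have "F ` {..<k} = {..<k}" by (simp add: inj_image_eq_iff inj_on_def)
    ultimately show ?packing
      unfolding nat_iff[OF F] using assms len_pos by (intro bij_betw_progressions) auto
  qed
qed

end

section \<open>Return to the original parameters\<close>

text \<open>Cancelling \<open>l\<close> in the divisibility hypothesis gives
  \<open>N dvd l * M\<^sup>2\<close>, and coprimality of \<open>N\<close> and \<open>M\<close> then
  gives \<open>N dvd l\<close>.\<close>

lemma staircases_exist:
  fixes n m :: nat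
  assumes "n > 0" "m > 0" "n dvd (m - 1)\<^sup>2"
  defines "l \<equiv> gcd n (m - 1)"
  obtains q where "staircases n m l (n div l) ((m - 1) div l) q"
proof -
  define N M where "N = n div l" and "M = (m - 1) div l"
  have "l > 0" using assms by simp
  have n: "n = l * N" and M: "m - 1 = l * M" by (simp_all add: N_def M_def l_def)
  have cop: "coprime N M" unfolding N_def M_def l_def using assms by (intro div_gcd_coprime) simp
  have "l * N dvd l * (l * M\<^sup>2)" using assms(3) n M by (simp add: power2_eq_square ac_simps)
  then have "N dvd l * M\<^sup>2" using \<open>l > 0\<close> by simp
  then have "N dvd l" using cop by (simp add: coprime_dvd_mult_left_iff)
  then obtain q where q: "l = N * q" ..
  have "staircases n m l N M q"
    using n M q cop assms \<open>l > 0\<close> by unfold_locales auto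
  then show thesis using that by (simp add: N_def M_def)
qed

theorem theorem3:
  fixes n m l k :: nat and p :: "real poly poly"
  assumes "n > 0" and "m > 0" and "coprime n m"
    and "n dvd (m - 1)\<^sup>2"
    and "l = gcd n (m - 1)"
    and "k > 0"
  shows "ascending_stair_packing_poly k n m p \<longleftrightarrow>
    stair_poly k n m p \<and>
    [k = (m - 1) div l] (mod (n div l)) \<and>
    (\<exists>f::real. \<forall>x y. eval2 p (x, y) =
       real n / 2 * (x - (real m - 1) / real n * y)\<^sup>2
       + (1 - real k * real l / 2) * x
       + (2 * (1 - real m) + real k * real l * (real m + 1)) / (2 * real n) * y + f) \<and>
    eval2 p ` first_stair n m ` {..<k} = real ` {..<k}"
    (is "_ \<longleftrightarrow> _ \<and> ?cong \<and> (\<exists>f. \<forall>x y. eval2 p (x, y) = ?Q x y f) \<and> ?init")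
proof -
  define N M where "N = n div l" and "M = (m - 1) div l"
  obtain q where "staircases n m l N M q"
    using staircases_exist assms unfolding N_def M_def by metis
  then interpret staircases n m l N M q .
  have pos: "real N > 0" "real l > 0" using N l_pos by simp_all
  define b where "b a = (real k - a * real M) / real N" for a
  have b: "a * real M + b a * real N = real k" for a
    using pos by (simp add: b_def)
  \<comment> \<open>\<open>b a\<close> is the coefficient of \<open>y\<close> forced by the step
    \<open>k\<close>; for \<open>a = 1 - k * l / 2\<close> it is the one claimed.\<close>
  have Q: "?Q x y f = real n / 2 * (x - (real m - 1) / real n * y)\<^sup>2 +
      (1 - real k * real l / 2) * x + b (1 - real k * real l / 2) * y + f" for x y f
    using pos by (simp add: b_def n m field_simps)
  have eval_p: "eval2 p (stair c j) = start a f k c + real k * real j"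
    if "\<And>x y. eval2 p (x, y) =
      real n / 2 * (x - (real m - 1) / real n * y)\<^sup>2 + a * x + b a * y + f" for a f c j
    using that b by (rule eval_stair_start)
  have init: "?init \<longleftrightarrow> start a f k ` {..<k} = real ` {..<k}"
    if "\<And>c j. eval2 p (stair c j) = start a f k c + real k * real j" for a f
    by (simp add: image_image first_stair_eq that)
  have packing: "packing_poly (real n / real m) p \<longleftrightarrow>
      a = 1 - real k * real l / 2 \<and> ?cong \<and> ?init"
    if "\<And>c j. eval2 p (stair c j) = start a f k c + real k * real j" for a f
    using packing_iff[OF \<open>k > 0\<close>, of a f]
    unfolding packing_poly_iff init[OF that] that unfolding N_def M_def .
  show ?thesis
  proof
    assume "ascending_stair_packing_poly k n m p"
    then have stair_p: "stair_poly k n m p"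
      and asc: "\<And>r s. consecutive_stairs n m r s \<Longrightarrow> norm r < norm s \<Longrightarrow>
        eval2 p s - eval2 p r = real k"
      and pack: "packing_poly (real n / real m) p"
      by (auto simp: ascending_stair_packing_poly_def ascending_stair_poly_def)
    obtain a b' f where "\<And>x y. eval2 p (x, y) = eval2 (hom_part 2 p) (x, y) + a * x + b' * y + f"
      using eval2_quadratic stair_p unfolding stair_poly_def by metis
    then have p: "\<And>x y. eval2 p (x, y) =
        real n / 2 * (x - (real m - 1) / real n * y)\<^sup>2 + a * x + b' * y + f"
      using stair_p unfolding stair_poly_def by simp
    have "eval2 p (stair N 1) - eval2 p (stair N 0) = a * real M + b' * real N"
      unfolding eval_stair[OF p] using pos by (simp add: field_simps)
    moreover have "eval2 p (stair N 1) - eval2 p (stair N 0) = real k"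
      using consecutive_stairs_0_1 by (intro asc) (simp_all add: norm_stair_less_iff)
    ultimately have "a * real M + b' * real N = real k" by simp
    then have "b' = b a" using pos by (simp add: b_def field_simps)
    with p have p: "\<And>x y. eval2 p (x, y) =
        real n / 2 * (x - (real m - 1) / real n * y)\<^sup>2 + a * x + b a * y + f" by simp
    from packing[OF eval_p[OF p]] pack
    have params: "a = 1 - real k * real l / 2" ?cong ?init by simp_all
    show "stair_poly k n m p \<and> ?cong \<and> (\<exists>f. \<forall>x y. eval2 p (x, y) = ?Q x y f) \<and> ?init"
      using stair_p params p unfolding Q by blast
  next
    assume rhs: "stair_poly k n m p \<and> ?cong \<and> (\<exists>f. \<forall>x y. eval2 p (x, y) = ?Q x y f) \<and> ?init"
    then obtain f where "\<And>x y. eval2 p (x, y) = ?Q x y f" by blast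
    then have val: "eval2 p (stair c j) = start (1 - real k * real l / 2) f k c + real k * real j" for c j
      unfolding Q by (rule eval_p)
    then have "packing_poly (real n / real m) p" using packing[OF val] rhs by simp
    moreover have "eval2 p s - eval2 p r = real k"
      if cons: "consecutive_stairs n m r s" and less: "norm r < norm s" for r s
    proof -
      obtain c i j where rs: "r = stair c i" "s = stair c j"
        using cons by (rule consecutive_stairsE)
      then have "i < j" using less by (simp add: norm_stair_less_iff)
      \<comment> \<open>A stair polynomial fixes the difference up to sign; growth along the index
        selects the sign.\<close>
      then have "eval2 p s - eval2 p r > 0" using \<open>k > 0\<close> by (simp add: rs val)
      moreover have "eval2 p r - eval2 p s = real k \<or> eval2 p r - eval2 p s = - real k"
        using rhs cons unfolding stair_poly_def by blast
      ultimately show ?thesis by auto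
    qed
    ultimately show "ascending_stair_packing_poly k n m p"
      using rhs by (simp add: ascending_stair_packing_poly_def ascending_stair_poly_def)
  qed
qed

end
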